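(* Let $\mathbb{H}$ be a real Hilbert space, let $A\ne0$ be a positive bounded linear operator on $\mathbb{H}$, let $T,S\in B_{A^{1/2}}(\mathbb{H})$ and let $\epsilon\in[0,1)$. Then the following conditions are equivalent: (i) $T\bot_{\epsilon(A)}S$. (ii) There exists a sequence $\{x_n\}\subseteq S_{\mathbb{H}(A)}$ such that (a) $\lim_{n\to\infty}\|Tx_n\|_A=\|T\|_A$; (b) $\lim_{n\to\infty}|\langle Tx_n,Sx_n\rangle_A|\le\epsilon\|T\|_A\|S\|_A$ (where the limit in (b) is in particular asserted to exist).
   Context: A bounded linear operator $A$ on $\mathbb{H}$ is positive if $A=A^*$ and $\langle Ax,x\rangle\ge0$ for all $x$. Put $\langle x,y\rangle_A=\langle Ax,y\rangle$, $\|x\|_A=\sqrt{\langle Ax,x\rangle}$, and $S_{\mathbb{H}(A)}=\{x\in\mathbb{H}:\|x\|_A=1\}$. $B_{A^{1/2}}(\mathbb{H})$ is the set of $A$-bounded operators, i.e. bounded linear operators $T$ on $\mathbb{H}$ for which there is $c>0$ with $\|Tx\|_A\le c\|x\|_A$ for all $x\in\mathbb{H}$; for such $T$, $\|T\|_A=\sup\{\|Tx\|_A:\|x\|_A=1\}$. For $T,S\in B_{A^{1/2}}(\mathbb{H})$, $T\bot_{\epsilon(A)}S$ means $\|T+\lambda S\|_A^2\ge\|T\|_A^2-2\epsilon\|T\|_A\|\lambda S\|_A$ for all scalars $\lambda$. *)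

theory Defs
  imports "HOL-Analysis.Analysis"
begin

text \<open>
  A real Hilbert space is a type of sort \<open>{real_inner, complete_space}\<close>, and the bounded linear
  operators on it are the elements of \<open>'a \<Rightarrow>\<^sub>L 'a\<close>.
\<close>

text \<open>
  \<^const>\<open>adjoint\<close> is a choice operator (some \<open>f'\<close> with \<open>f x \<bullet> y = x \<bullet> f' y\<close> for all \<open>x\<close>, \<open>y\<close>);
  by completeness every bounded operator has such an \<open>f'\<close>, and it is unique.
\<close>
definition positive_op :: "('a::{real_inner,complete_space} \<Rightarrow>\<^sub>L 'a) \<Rightarrow> bool" where
  "positive_op A \<longleftrightarrow> blinfun_apply A = adjoint (blinfun_apply A) \<and> (\<forall>x. 0 \<le> A x \<bullet> x)"

definition inner_A :: "('a::{real_inner,complete_space} \<Rightarrow>\<^sub>L 'a) \<Rightarrow> 'a \<Rightarrow> 'a \<Rightarrow> real" where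
  "inner_A A x y = A x \<bullet> y"

definition norm_A :: "('a::{real_inner,complete_space} \<Rightarrow>\<^sub>L 'a) \<Rightarrow> 'a \<Rightarrow> real" where
  "norm_A A x = sqrt (A x \<bullet> x)"

definition sphere_A :: "('a::{real_inner,complete_space} \<Rightarrow>\<^sub>L 'a) \<Rightarrow> 'a set" where
  "sphere_A A = {x. norm_A A x = 1}"

definition bounded_ops_A :: "('a::{real_inner,complete_space} \<Rightarrow>\<^sub>L 'a) \<Rightarrow> ('a \<Rightarrow>\<^sub>L 'a) set" where
  "bounded_ops_A A = {T :: 'a \<Rightarrow>\<^sub>L 'a. \<exists>c>0. \<forall>x. norm_A A (T x) \<le> c * norm_A A x}"

text \<open>
  The supremum is over a nonempty set bounded above whenever \<open>A\<close> is positive and nonzero and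
  \<open>T \<in> bounded_ops_A A\<close>; otherwise its value carries no meaning.
\<close>
definition opnorm_A :: "('a::{real_inner,complete_space} \<Rightarrow>\<^sub>L 'a) \<Rightarrow> ('a \<Rightarrow>\<^sub>L 'a) \<Rightarrow> real" where
  "opnorm_A A T = Sup {norm_A A (T x) |x. norm_A A x = 1}"

definition approx_orth_A ::
    "real \<Rightarrow> ('a::{real_inner,complete_space} \<Rightarrow>\<^sub>L 'a) \<Rightarrow> ('a \<Rightarrow>\<^sub>L 'a) \<Rightarrow> ('a \<Rightarrow>\<^sub>L 'a) \<Rightarrow> bool" where
  "approx_orth_A \<epsilon> A T S \<longleftrightarrow>
    (\<forall>\<mu>::real. (opnorm_A A (T + \<mu> *\<^sub>R S))\<^sup>2
       \<ge> (opnorm_A A T)\<^sup>2 - 2 * \<epsilon> * opnorm_A A T * opnorm_A A (\<mu> *\<^sub>R S))"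

end

theory Submission
  imports Defs
begin

text \<open>
  Write \<open>t\<close> and \<open>s\<close> for the \<open>A\<close>-norms of \<open>T\<close> and \<open>S\<close>. Condition (i) for a small scalar of either sign
  yields approximate maximisers \<open>x\<close>, \<open>y\<close> of \<open>\<parallel>T\<cdot>\<parallel>\<^sub>A\<close> on the sphere with \<open>\<langle>Tx, Sx\<rangle>\<^sub>A \<ge> - \<epsilon>ts - o(1)\<close>
  and \<open>\<langle>Ty, Sy\<rangle>\<^sub>A \<le> \<epsilon>ts + o(1)\<close>. If neither of them already makes \<open>\<bar>\<langle>T\<cdot>, S\<cdot>\<rangle>\<^sub>A\<bar>\<close> at most
  \<open>\<epsilon>ts + o(1)\<close>, then \<open>\<langle>T\<cdot>, S\<cdot>\<rangle>\<^sub>A\<close> vanishes somewhere on the segment from \<open>x\<close> to \<open>y\<close>. Since the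
  quadratic form \<open>t\<^sup>2\<parallel>z\<parallel>\<^sub>A\<^sup>2 - \<parallel>Tz\<parallel>\<^sub>A\<^sup>2\<close> is nonnegative, hence convex, all points of the segment
  remain approximate maximisers; replacing \<open>y\<close> by \<open>-y\<close> if \<open>\<langle>x, y\<rangle>\<^sub>A < 0\<close> keeps the segment away from
  the kernel of \<open>A\<close>. A compactness argument then makes the numbers \<open>\<bar>\<langle>Tx\<^sub>n, Sx\<^sub>n\<rangle>\<^sub>A\<bar>\<close> converge.
\<close>

section \<open>Riesz representation and adjoints of bounded operators\<close>

text \<open>The representing vector minimises \<open>\<parallel>x\<parallel>\<^sup>2 - 2 f x\<close>.\<close>
lemma riesz_representation:
  fixes f :: "'a::{real_inner,complete_space} \<Rightarrow> real"
  assumes "bounded_linear f"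
  shows "\<exists>z. \<forall>x. f x = x \<bullet> z"
proof -
  interpret f: bounded_linear f by fact
  define \<phi> where "\<phi> x = x \<bullet> x - 2 * f x" for x
  obtain K where K: "\<And>x. norm (f x) \<le> norm x * K"
    using f.bounded by blast
  have "\<phi> x \<ge> - K\<^sup>2" for x
  proof -
    have "0 \<le> (norm x - K)\<^sup>2" by simp
    also have "(norm x - K)\<^sup>2 = x \<bullet> x - 2 * (norm x * K) + K\<^sup>2"
      by (simp add: power2_diff power2_norm_eq_inner)
    also have "\<dots> \<le> \<phi> x + K\<^sup>2"
      using K[of x] by (simp add: \<phi>_def)
    finally show ?thesis by simp
  qed
  then have bdd: "bdd_below (range \<phi>)"
    by (meson bdd_belowI2)
  define d where "d = Inf (range \<phi>)"
  have d_le: "d \<le> \<phi> x" for x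
    unfolding d_def using bdd by (simp add: cINF_lower)
  have "\<exists>x. \<phi> x < d + inverse (real (Suc n))" for n
    using cInf_less_iff[of "range \<phi>" "d + inverse (real (Suc n))"] bdd
    by (auto simp: d_def)
  then obtain u where u: "\<And>n. \<phi> (u n) < d + inverse (real (Suc n))"
    by metis
  \<comment> \<open>The midpoint of \<open>x\<close> and \<open>y\<close> also has value at least
    \<open>d\<close>, so two points with nearly minimal value must be close together. This makes the
    minimising sequence \<open>u\<close> Cauchy.\<close>
  have parallelogram: "(norm (x - y))\<^sup>2 \<le> 2 * \<phi> x + 2 * \<phi> y - 4 * d" for x y
  proof -
    have "(norm (x - y))\<^sup>2 = 2 * \<phi> x + 2 * \<phi> y - 4 * \<phi> ((1/2) *\<^sub>R (x + y))"
      unfolding \<phi>_def f.scaleR f.add power2_norm_eq_inner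
      by (simp add: inner_simps inner_commute field_simps)
    then show ?thesis using d_le[of "(1/2) *\<^sub>R (x + y)"] by simp
  qed
  have "Cauchy u"
  proof (rule metric_CauchyI)
    fix e :: real assume "0 < e"
    then obtain N where "inverse (real (Suc N)) < e\<^sup>2 / 4"
      using reals_Archimedean[of "e\<^sup>2 / 4"] by auto
    then have N: "4 * inverse (real (Suc N)) < e\<^sup>2"
      unfolding less_divide_eq_numeral1 by (simp only: mult.commute)
    have small: "4 * \<phi> (u n) < 4 * d + e\<^sup>2" if "n \<ge> N" for n
    proof -
      have "\<phi> (u n) < d + inverse (real (Suc N))"
        using that by (intro less_le_trans[OF u] add_left_mono) (simp add: field_simps)
      with N show ?thesis by linarith
    qed
    have "dist (u m) (u n) < e" if "m \<ge> N" "n \<ge> N" for m n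
    proof -
      have "(norm (u m - u n))\<^sup>2 < e\<^sup>2"
        using parallelogram[of "u m" "u n"] small[OF that(1)] small[OF that(2)] by linarith
      then show ?thesis
        using \<open>0 < e\<close> by (simp add: dist_norm power_less_imp_less_base)
    qed
    then show "\<exists>M. \<forall>m\<ge>M. \<forall>n\<ge>M. dist (u m) (u n) < e" by blast
  qed
  then obtain z where z: "u \<longlonglongrightarrow> z"
    using Cauchy_convergent convergent_def by blast
  have "(\<lambda>n. \<phi> (u n)) \<longlonglongrightarrow> \<phi> z"
    unfolding \<phi>_def by (intro tendsto_intros f.tendsto z)
  moreover have "(\<lambda>n. d + inverse (real (Suc n))) \<longlonglongrightarrow> d + 0"
    by (intro tendsto_intros LIMSEQ_inverse_real_of_nat)
  ultimately have "\<phi> z \<le> d"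
    using u by (intro LIMSEQ_le[of "\<lambda>n. \<phi> (u n)" _ "\<lambda>n. d + inverse (real (Suc n))"])
      (auto intro: less_imp_le)
  then have min: "\<phi> z \<le> \<phi> x" for x
    using d_le[of x] by linarith
  have "f h = h \<bullet> z" for h
  proof (cases "h = 0")
    case False
    then have pos: "h \<bullet> h > 0" by simp
    \<comment> \<open>\<open>c\<close> is half the derivative of \<open>\<phi>\<close> at
      \<open>z\<close> in direction \<open>h\<close>, and the step
      \<open>c / (h \<bullet> h)\<close> is the best one along that line. It lowers the value by
      exactly \<open>c\<^sup>2 / (h \<bullet> h)\<close>, so minimality of \<open>z\<close> forces
      \<open>c = 0\<close>.\<close>
    define c where "c = h \<bullet> z - f h"
    have "\<phi> (z - (c / (h \<bullet> h)) *\<^sub>R h) = \<phi> z - c\<^sup>2 / (h \<bullet> h)"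
      unfolding \<phi>_def f.diff f.scaleR c_def using pos
      by (simp add: inner_simps inner_commute[of z h] field_simps power2_eq_square)
    with min[of "z - (c / (h \<bullet> h)) *\<^sub>R h"] have "c\<^sup>2 / (h \<bullet> h) \<le> 0" by linarith
    with pos have "c = 0" by (auto simp: divide_le_0_iff not_le[symmetric])
    then show ?thesis by (simp add: c_def)
  qed (simp add: f.zero)
  then show ?thesis by blast
qed

text \<open>Since \<open>adjoint\<close> is a choice, its defining identity needs a witness: the
  Riesz vectors of the functionals \<open>\<lambda>x. F x \<bullet> y\<close>, collected into one
  function of \<open>y\<close>.\<close>

lemma blinfun_adjoint_works:
  fixes F :: "'a::{real_inner,complete_space} \<Rightarrow>\<^sub>L 'b::real_inner"
  shows "F x \<bullet> y = x \<bullet> adjoint F y"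
proof -
  have "bounded_linear (\<lambda>x. F x \<bullet> y)" for y
    by (intro bounded_linear_inner_left_comp blinfun.bounded_linear_right)
  then have "\<exists>z. \<forall>x. F x \<bullet> y = x \<bullet> z" for y
    by (rule riesz_representation)
  then have "\<exists>G. \<forall>x y. F x \<bullet> y = x \<bullet> G y" by metis
  then show ?thesis
    unfolding adjoint_def by (rule someI2_ex) blast
qed

section \<open>The semi-inner product of a positive operator\<close>

locale positive_operator =
  fixes A :: "'a::{real_inner,complete_space} \<Rightarrow>\<^sub>L 'a"
  assumes positive: "positive_op A"
begin

lemma inner_A_commute: "inner_A A x y = inner_A A y x"
  using positive blinfun_adjoint_works[of A x y]
  by (simp add: positive_op_def inner_A_def inner_commute)

lemma inner_A_nonneg [simp]: "0 \<le> inner_A A x x"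
  using positive by (simp add: positive_op_def inner_A_def)

lemma inner_A_add_left: "inner_A A (x + y) z = inner_A A x z + inner_A A y z"
  by (simp add: inner_A_def blinfun.bilinear_simps inner_simps)

lemma inner_A_add_right: "inner_A A z (x + y) = inner_A A z x + inner_A A z y"
  by (simp add: inner_A_def inner_simps)

lemma inner_A_scaleR_left: "inner_A A (r *\<^sub>R x) y = r * inner_A A x y"
  by (simp add: inner_A_def blinfun.bilinear_simps)

lemma inner_A_scaleR_right: "inner_A A x (r *\<^sub>R y) = r * inner_A A x y"
  by (simp add: inner_A_def)

lemma inner_A_diff_left: "inner_A A (x - y) z = inner_A A x z - inner_A A y z"
  by (simp add: inner_A_def blinfun.bilinear_simps inner_simps)

lemma inner_A_diff_right: "inner_A A z (x - y) = inner_A A z x - inner_A A z y"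
  by (simp add: inner_A_def inner_simps)

lemma inner_A_minus_left: "inner_A A (- x) y = - inner_A A x y"
  by (simp add: inner_A_def blinfun.bilinear_simps)

lemma inner_A_minus_right: "inner_A A x (- y) = - inner_A A x y"
  by (simp add: inner_A_def)

lemmas inner_A_simps = inner_A_add_left inner_A_add_right inner_A_scaleR_left
  inner_A_scaleR_right inner_A_diff_left inner_A_diff_right inner_A_minus_left inner_A_minus_right

lemma norm_A_nonneg [simp]: "0 \<le> norm_A A x"
  using inner_A_nonneg by (simp add: norm_A_def inner_A_def)

lemma power2_norm_A: "(norm_A A x)\<^sup>2 = inner_A A x x"
  using inner_A_nonneg by (simp add: norm_A_def inner_A_def)

lemma norm_A_eq_sqrt: "norm_A A x = sqrt (inner_A A x x)"
  by (simp add: norm_A_def inner_A_def)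

lemma norm_A_scaleR: "norm_A A (r *\<^sub>R x) = \<bar>r\<bar> * norm_A A x"
  by (simp add: norm_A_eq_sqrt inner_A_simps real_sqrt_mult flip: mult.assoc)

lemma norm_A_minus [simp]: "norm_A A (- x) = norm_A A x"
  by (simp add: norm_A_eq_sqrt inner_A_simps)

text \<open>The form may be degenerate, so \<open>inner_A A y y = 0\<close> does not give
  \<open>y = 0\<close> and needs its own argument.\<close>

lemma inner_A_Cauchy_Schwarz: "(inner_A A x y)\<^sup>2 \<le> inner_A A x x * inner_A A y y"
proof (cases "inner_A A y y = 0")
  case True
  have "inner_A A x y = 0"
  proof (rule ccontr)
    assume nz: "inner_A A x y \<noteq> 0"
    \<comment> \<open>For a null vector \<open>y\<close> the form at
      \<open>x + k *\<^sub>R y\<close> is affine in \<open>k\<close>; this \<open>k\<close> gives it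
      the value -1, against positivity.\<close>
    define k where "k = - (inner_A A x x + 1) / (2 * inner_A A x y)"
    have "inner_A A (x + k *\<^sub>R y) (x + k *\<^sub>R y) = inner_A A x x + 2 * k * inner_A A x y"
      using True inner_A_commute[of y x] by (simp add: inner_A_simps)
    also have "\<dots> = - 1"
      using nz by (simp add: k_def field_simps)
    finally show False
      using inner_A_nonneg[of "x + k *\<^sub>R y"] by linarith
  qed
  then show ?thesis using True by simp
next
  case False
  then have pos: "inner_A A y y > 0"
    using inner_A_nonneg[of y] by linarith
  \<comment> \<open>Coefficient of the projection of \<open>x\<close> onto \<open>y\<close>, which
    minimises the form along \<open>x - k *\<^sub>R y\<close>.\<close>
  define k where "k = inner_A A x y / inner_A A y y"
  have "inner_A A (x - k *\<^sub>R y) (x - k *\<^sub>R y)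
      = inner_A A x x - 2 * k * inner_A A x y + k * (k * inner_A A y y)"
    using inner_A_commute[of y x] by (simp add: inner_A_simps algebra_simps)
  also have "k * inner_A A y y = inner_A A x y"
    using pos by (simp add: k_def)
  finally have "0 \<le> inner_A A x x - k * inner_A A x y"
    using inner_A_nonneg[of "x - k *\<^sub>R y"] by simp
  then show ?thesis
    using pos by (simp add: k_def field_simps power2_eq_square)
qed

lemma abs_inner_A_le: "\<bar>inner_A A x y\<bar> \<le> norm_A A x * norm_A A y"
proof (rule power2_le_imp_le)
  show "\<bar>inner_A A x y\<bar>\<^sup>2 \<le> (norm_A A x * norm_A A y)\<^sup>2"
    using inner_A_Cauchy_Schwarz by (simp add: power_mult_distrib power2_norm_A)
qed simp

lemma norm_A_triangle: "norm_A A (x + y) \<le> norm_A A x + norm_A A y"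
proof (rule power2_le_imp_le)
  have "(norm_A A (x + y))\<^sup>2 = (norm_A A x)\<^sup>2 + 2 * inner_A A x y + (norm_A A y)\<^sup>2"
    using inner_A_commute[of y x] by (simp add: power2_norm_A inner_A_simps)
  also have "\<dots> \<le> (norm_A A x + norm_A A y)\<^sup>2"
    using abs_inner_A_le[of x y] by (simp add: power2_sum)
  finally show "(norm_A A (x + y))\<^sup>2 \<le> (norm_A A x + norm_A A y)\<^sup>2" .
qed simp

lemma sphere_A_iff: "x \<in> sphere_A A \<longleftrightarrow> norm_A A x = 1"
  by (simp add: sphere_A_def)

lemma normalise_in_sphere_A:
  assumes "norm_A A x \<noteq> 0"
  shows "(1 / norm_A A x) *\<^sub>R x \<in> sphere_A A"
  using assms by (simp add: sphere_A_iff norm_A_scaleR)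

text \<open>If \<open>x\<close> has seminorm 0, Cauchy-Schwarz against \<open>A x\<close> gives
  \<open>A x \<bullet> A x = 0\<close>. Hence any \<open>x\<close> with
  \<open>A x \<noteq> 0\<close> can be normalised.\<close>

lemma sphere_A_nonempty:
  assumes "A \<noteq> 0"
  shows "sphere_A A \<noteq> {}"
proof -
  obtain x where x: "A x \<noteq> 0"
    using assms by (metis blinfun_eqI zero_blinfun.rep_eq)
  have "norm_A A x \<noteq> 0"
  proof
    assume "norm_A A x = 0"
    then have "inner_A A x (A x) = 0"
      using abs_inner_A_le[of x "A x"] by simp
    with x show False by (simp add: inner_A_def)
  qed
  then show ?thesis using normalise_in_sphere_A by blast
qed

section \<open>A-bounded operators and their action on the A-sphere\<close>

lemma bounded_ops_A_add:
  assumes "T \<in> bounded_ops_A A" "S \<in> bounded_ops_A A"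
  shows "T + S \<in> bounded_ops_A A"
proof -
  from assms obtain c d where "c > 0" "d > 0"
    and c: "\<And>x. norm_A A (T x) \<le> c * norm_A A x" and d: "\<And>x. norm_A A (S x) \<le> d * norm_A A x"
    by (auto simp: bounded_ops_A_def)
  have "norm_A A ((T + S) x) \<le> (c + d) * norm_A A x" for x
    using norm_A_triangle[of "T x" "S x"] c[of x] d[of x]
    by (simp add: blinfun.bilinear_simps distrib_right)
  then show ?thesis
    using \<open>c > 0\<close> \<open>d > 0\<close> by (auto simp: bounded_ops_A_def intro!: exI[of _ "c + d"])
qed

lemma bounded_ops_A_scaleR:
  assumes "T \<in> bounded_ops_A A"
  shows "r *\<^sub>R T \<in> bounded_ops_A A"
proof -
  from assms obtain c where "c > 0" and c: "\<And>x. norm_A A (T x) \<le> c * norm_A A x"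
    by (auto simp: bounded_ops_A_def)
  \<comment> \<open>The summand 1 keeps the constant positive when \<open>r = 0\<close>.\<close>
  have "norm_A A ((r *\<^sub>R T) x) \<le> ((\<bar>r\<bar> + 1) * c) * norm_A A x" for x
  proof -
    have "norm_A A ((r *\<^sub>R T) x) = \<bar>r\<bar> * norm_A A (T x)"
      by (simp add: blinfun.bilinear_simps norm_A_scaleR)
    also have "\<dots> \<le> (\<bar>r\<bar> + 1) * (c * norm_A A x)"
      using c[of x] by (intro mult_mono) auto
    finally show ?thesis by (simp add: mult.assoc)
  qed
  moreover have "(\<bar>r\<bar> + 1) * c > 0"
    using \<open>c > 0\<close> by (intro mult_pos_pos) auto
  ultimately show ?thesis
    by (auto simp: bounded_ops_A_def)
qed

lemma opnorm_A_eq_SUP: "opnorm_A A T = (SUP x\<in>sphere_A A. norm_A A (T x))"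
  unfolding opnorm_A_def by (rule arg_cong[of _ _ Sup]) (auto simp: sphere_A_iff)

lemma bdd_above_sphere_A_image:
  assumes "T \<in> bounded_ops_A A"
  shows "bdd_above ((\<lambda>x. norm_A A (T x)) ` sphere_A A)"
proof -
  from assms obtain c where "\<And>x. norm_A A (T x) \<le> c * norm_A A x"
    by (auto simp: bounded_ops_A_def)
  then have "\<And>x. x \<in> sphere_A A \<Longrightarrow> norm_A A (T x) \<le> c"
    by (metis sphere_A_iff mult.right_neutral)
  then show ?thesis by (rule bdd_aboveI2)
qed

lemma norm_A_apply_le_sphere:
  assumes "T \<in> bounded_ops_A A" "x \<in> sphere_A A"
  shows "norm_A A (T x) \<le> opnorm_A A T"
  unfolding opnorm_A_eq_SUP
  using bdd_above_sphere_A_image[OF assms(1)] assms(2) by (rule cSUP_upper2) simp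

lemma norm_A_apply_le:
  assumes "T \<in> bounded_ops_A A"
  shows "norm_A A (T x) \<le> opnorm_A A T * norm_A A x"
proof (cases "norm_A A x = 0")
  case True
  \<comment> \<open>A null vector cannot be normalised, but an A-bounded operator maps it to a null
    vector.\<close>
  with assms have "norm_A A (T x) \<le> 0"
    by (auto simp: bounded_ops_A_def dest!: spec[of _ x])
  with True show ?thesis by simp
next
  case False
  then have pos: "norm_A A x > 0"
    using norm_A_nonneg[of x] by linarith
  have "norm_A A (T ((1 / norm_A A x) *\<^sub>R x)) \<le> opnorm_A A T"
    using assms normalise_in_sphere_A[OF False] by (rule norm_A_apply_le_sphere)
  then show ?thesis
    using pos by (simp add: blinfun.bilinear_simps norm_A_scaleR field_simps)
qed

end

section \<open>The operator seminorm over a nonempty sphere\<close>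

locale nonzero_positive_operator = positive_operator +
  assumes nonzero: "A \<noteq> 0"
begin

lemma opnorm_A_nonneg:
  assumes "T \<in> bounded_ops_A A"
  shows "0 \<le> opnorm_A A T"
proof -
  obtain x where "x \<in> sphere_A A" using sphere_A_nonempty[OF nonzero] by blast
  from norm_A_apply_le_sphere[OF assms this] norm_A_nonneg[of "T x"] show ?thesis by linarith
qed

lemma opnorm_A_power2_approx:
  assumes "T \<in> bounded_ops_A A" "r < (opnorm_A A T)\<^sup>2"
  obtains x where "x \<in> sphere_A A" "r < (norm_A A (T x))\<^sup>2"
proof -
  \<comment> \<open>\<open>r\<close> may be negative; \<open>sqrt\<close> is odd and strictly
    increasing on all reals, so no case distinction arises.\<close>
  have "sqrt r < opnorm_A A T"
    using real_sqrt_less_mono[OF assms(2)] opnorm_A_nonneg[OF assms(1)] by simp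
  then obtain x where x: "x \<in> sphere_A A" "sqrt r < norm_A A (T x)"
    unfolding opnorm_A_eq_SUP
    using less_cSUP_iff[OF sphere_A_nonempty[OF nonzero] bdd_above_sphere_A_image[OF assms(1)]]
    by blast
  from x(2) have "r < (norm_A A (T x))\<^sup>2"
    by (metis norm_A_nonneg real_sqrt_less_iff real_sqrt_unique)
  with x(1) show thesis by (rule that)
qed

lemma opnorm_A_scaleR:
  assumes "T \<in> bounded_ops_A A"
  shows "opnorm_A A (r *\<^sub>R T) = \<bar>r\<bar> * opnorm_A A T"
proof -
  \<comment> \<open>Stated for all \<open>r\<close> and \<open>T\<close>, so that the reverse
    inequality follows from applying it to \<open>1 / r\<close> and
    \<open>r *\<^sub>R T\<close>.\<close>
  have le: "opnorm_A A (r *\<^sub>R T) \<le> \<bar>r\<bar> * opnorm_A A T" if "T \<in> bounded_ops_A A" for r T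
    unfolding opnorm_A_eq_SUP[of "r *\<^sub>R T"]
    using norm_A_apply_le_sphere[OF that] sphere_A_nonempty[OF nonzero]
    by (intro cSUP_least) (auto simp: blinfun.bilinear_simps norm_A_scaleR intro!: mult_left_mono)
  show ?thesis
  proof (cases "r = 0")
    case True
    then show ?thesis
      using le[OF assms, of 0] opnorm_A_nonneg[OF bounded_ops_A_scaleR[OF assms, of 0]] by simp
  next
    case False
    then have "\<bar>r\<bar> * opnorm_A A T \<le> opnorm_A A (r *\<^sub>R T)"
      using le[OF bounded_ops_A_scaleR[OF assms, of r], of "1 / r"] by (simp add: field_simps)
    with le[OF assms, of r] show ?thesis by simp
  qed
qed

section \<open>Approximate maximisers with controlled inner product\<close>

lemma power2_norm_A_add_scaleR:
  fixes T S :: "'a \<Rightarrow>\<^sub>L 'a"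
  shows "(norm_A A ((T + r *\<^sub>R S) x))\<^sup>2
    = (norm_A A (T x))\<^sup>2 + 2 * r * inner_A A (T x) (S x) + r\<^sup>2 * (norm_A A (S x))\<^sup>2"
  using inner_A_commute[of "S x" "T x"]
  by (simp add: power2_norm_A blinfun.bilinear_simps inner_A_simps algebra_simps)
    (simp add: power2_eq_square)

text \<open>Take \<open>x\<close> whose image under \<open>T + r *\<^sub>R S\<close> has squared
  seminorm within \<open>r\<^sup>2\<close> of the lower bound given by orthogonality, and expand the
  square. Bounding the cross term from above shows that \<open>x\<close> nearly maximises
  \<open>T\<close>; bounding the \<open>T\<close> term from above and dividing by \<open>r\<close>
  controls the cross term from below.\<close>

lemma approx_maximiser_inner_A_ge:
  assumes T: "T \<in> bounded_ops_A A" and S: "S \<in> bounded_ops_A A"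
    and "approx_orth_A \<epsilon> A T S" "0 < r"
  obtains x where "x \<in> sphere_A A"
    "(norm_A A (T x))\<^sup>2 \<ge> (opnorm_A A T)\<^sup>2
       - r * (2 * \<epsilon> * opnorm_A A T * opnorm_A A S + 2 * opnorm_A A T * opnorm_A A S
              + r * (1 + (opnorm_A A S)\<^sup>2))"
    "inner_A A (T x) (S x) \<ge> - \<epsilon> * opnorm_A A T * opnorm_A A S - r * (1 + (opnorm_A A S)\<^sup>2)"
proof -
  let ?t = "opnorm_A A T" and ?s = "opnorm_A A S"
  have "(opnorm_A A (T + r *\<^sub>R S))\<^sup>2 \<ge> ?t\<^sup>2 - 2 * \<epsilon> * ?t * opnorm_A A (r *\<^sub>R S)"
    using assms(3) by (simp add: approx_orth_A_def)
  then have "?t\<^sup>2 - 2 * \<epsilon> * ?t * (r * ?s) - r\<^sup>2 < (opnorm_A A (T + r *\<^sub>R S))\<^sup>2"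
    unfolding opnorm_A_scaleR[OF S] abs_of_pos[OF \<open>0 < r\<close>]
    using zero_less_power[OF \<open>0 < r\<close>, of 2] by linarith
  then obtain x where x: "x \<in> sphere_A A"
    and "?t\<^sup>2 - 2 * \<epsilon> * ?t * (r * ?s) - r\<^sup>2 < (norm_A A ((T + r *\<^sub>R S) x))\<^sup>2"
    using opnorm_A_power2_approx[OF bounded_ops_A_add[OF T bounded_ops_A_scaleR[OF S]]] by metis
  then have less: "?t\<^sup>2 - 2 * \<epsilon> * ?t * (r * ?s) - r\<^sup>2
      < (norm_A A (T x))\<^sup>2 + 2 * (r * inner_A A (T x) (S x)) + r\<^sup>2 * (norm_A A (S x))\<^sup>2"
    by (simp add: power2_norm_A_add_scaleR)
  have Tx: "norm_A A (T x) \<le> ?t" and Sx: "norm_A A (S x) \<le> ?s"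
    using norm_A_apply_le_sphere x T S by auto
  have Tx2: "(norm_A A (T x))\<^sup>2 \<le> ?t\<^sup>2" and Sx2: "r\<^sup>2 * (norm_A A (S x))\<^sup>2 \<le> r\<^sup>2 * ?s\<^sup>2"
    using Tx Sx by (auto intro!: power_mono mult_left_mono)
  have "inner_A A (T x) (S x) \<le> norm_A A (T x) * norm_A A (S x)"
    using abs_inner_A_le[of "T x" "S x"] by linarith
  also have "\<dots> \<le> ?t * ?s"
    using Tx Sx opnorm_A_nonneg[OF T] by (intro mult_mono) auto
  finally have "r * inner_A A (T x) (S x) \<le> r * (?t * ?s)"
    using \<open>0 < r\<close> by simp
  with less Sx2 have 1: "(norm_A A (T x))\<^sup>2 \<ge> ?t\<^sup>2
       - r * (2 * \<epsilon> * ?t * ?s + 2 * ?t * ?s + r * (1 + ?s\<^sup>2))"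
    by (simp add: algebra_simps power2_eq_square)
  have "0 \<le> r * (2 * inner_A A (T x) (S x) + 2 * \<epsilon> * ?t * ?s + r * (1 + ?s\<^sup>2))"
    using less Sx2 Tx2 by (simp add: algebra_simps power2_eq_square)
  then have "0 \<le> 2 * inner_A A (T x) (S x) + 2 * \<epsilon> * ?t * ?s + r * (1 + ?s\<^sup>2)"
    using \<open>0 < r\<close> by (simp add: zero_le_mult_iff)
  \<comment> \<open>Halving the previous inequality leaves an error of
    \<open>r * (1 + ?s\<^sup>2) / 2\<close>; nonnegativity allows the simpler, larger error.\<close>
  moreover have "0 \<le> r * (1 + ?s\<^sup>2)"
    using \<open>0 < r\<close> by simp
  ultimately have "inner_A A (T x) (S x) \<ge> - \<epsilon> * ?t * ?s - r * (1 + ?s\<^sup>2)"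
    by simp
  with x 1 show thesis by (rule that)
qed

text \<open>The intermediate value theorem finds the zero on the segment; the factor 2 on
  \<open>\<delta>\<close> is the price of normalising it.\<close>

lemma zero_of_inner_A_on_segment:
  fixes S T :: "'a \<Rightarrow>\<^sub>L 'a"
  assumes T: "T \<in> bounded_ops_A A"
    and x: "x \<in> sphere_A A" "(norm_A A (T x))\<^sup>2 \<ge> (opnorm_A A T)\<^sup>2 - \<delta>"
      "inner_A A (T x) (S x) \<ge> 0"
    and y: "y \<in> sphere_A A" "(norm_A A (T y))\<^sup>2 \<ge> (opnorm_A A T)\<^sup>2 - \<delta>"
      "inner_A A (T y) (S y) \<le> 0"
  obtains w where "w \<in> sphere_A A" "(norm_A A (T w))\<^sup>2 \<ge> (opnorm_A A T)\<^sup>2 - 2 * \<delta>"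
    "inner_A A (T w) (S w) = 0"
proof -
  let ?t = "opnorm_A A T"
  define y' where "y' = (if inner_A A x y \<ge> 0 then y else - y)"
  have y': "norm_A A y' = 1" "(norm_A A (T y'))\<^sup>2 \<ge> ?t\<^sup>2 - \<delta>" "inner_A A (T y') (S y') \<le> 0"
    "inner_A A x y' \<ge> 0"
    using y by (auto simp: y'_def sphere_A_iff blinfun.bilinear_simps inner_A_simps)
  define z where "z u = (1 - u) *\<^sub>R x + u *\<^sub>R y'" for u :: real
  have "continuous_on {0..1} (\<lambda>u. inner_A A (T (z u)) (S (z u)))"
    unfolding inner_A_def z_def by (intro continuous_intros)
  then obtain u where u: "0 \<le> u" "u \<le> 1" and zero: "inner_A A (T (z u)) (S (z u)) = 0"
    using IVT2'[of "\<lambda>u. inner_A A (T (z u)) (S (z u))" 1 0 0] x(3) y'(3)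
    by (auto simp: z_def)
  \<comment> \<open>On the sphere, \<open>q v \<le> \<delta>\<close> says precisely that
    \<open>v\<close> is a maximiser up to \<open>\<delta>\<close> in the square.\<close>
  define q where "q v = ?t\<^sup>2 * inner_A A v v - inner_A A (T v) (T v)" for v
  have q_nonneg: "0 \<le> q v" for v
    using power_mono[OF norm_A_apply_le[OF T, of v], of 2]
    by (simp add: q_def power_mult_distrib power2_norm_A)
  have "q x \<le> \<delta>" "q y' \<le> \<delta>"
    using x y' by (simp_all add: q_def sphere_A_iff flip: power2_norm_A)
  \<comment> \<open>The exact convexity identity of a quadratic form; its last term is discarded
    because \<open>q\<close> is nonnegative.\<close>
  have "q (z u) = (1 - u) * q x + u * q y' - u * (1 - u) * q (x - y')"
    unfolding q_def z_def
    using inner_A_commute[of y' x] inner_A_commute[of "T y'" "T x"]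
    by (simp add: blinfun.bilinear_simps inner_A_simps)
      (simp add: algebra_simps power2_eq_square)
  also have "\<dots> \<le> (1 - u) * \<delta> + u * \<delta> - 0"
    using u \<open>q x \<le> \<delta>\<close> \<open>q y' \<le> \<delta>\<close> q_nonneg[of "x - y'"]
    by (intro diff_mono add_mono mult_left_mono) auto
  finally have qz: "q (z u) \<le> \<delta>" by (simp add: algebra_simps)
  \<comment> \<open>The sign chosen for \<open>y'\<close> makes the cross term of the squared
    seminorm nonnegative, so the seminorm of \<open>z u\<close> is bounded away from 0.\<close>
  have "1 / 2 \<le> (1 - u)\<^sup>2 + u\<^sup>2"
    using zero_le_power2[of "1 - 2 * u"] by (simp add: power2_eq_square algebra_simps)
  also have "\<dots> \<le> (1 - u)\<^sup>2 + u\<^sup>2 + 2 * (u * (1 - u) * inner_A A x y')"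
    using u y'(4) by simp
  also have "\<dots> = (norm_A A (z u))\<^sup>2"
    using x(1) y'(1) inner_A_commute[of y' x] power2_norm_A[of x] power2_norm_A[of y']
    unfolding power2_norm_A[of "z u"] unfolding z_def
    by (simp add: inner_A_simps sphere_A_iff) (simp add: power2_eq_square algebra_simps)
  finally have half: "1 / 2 \<le> (norm_A A (z u))\<^sup>2" .
  then have nz: "norm_A A (z u) \<noteq> 0" by auto
  define w where "w = (1 / norm_A A (z u)) *\<^sub>R z u"
  have w: "w \<in> sphere_A A"
    unfolding w_def by (rule normalise_in_sphere_A[OF nz])
  \<comment> \<open>\<open>q\<close> is homogeneous of degree 2, so normalising a vector of squared
    seminorm at least 1/2 at most doubles its value.\<close>
  have "q w = q (z u) / (norm_A A (z u))\<^sup>2"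
    by (simp add: q_def w_def blinfun.bilinear_simps inner_A_simps diff_divide_distrib
        power2_eq_square)
  also have "\<dots> \<le> q (z u) / (1 / 2)"
    using half q_nonneg[of "z u"] by (intro divide_left_mono) auto
  also have "\<dots> \<le> 2 * \<delta>"
    using qz by simp
  finally have "(norm_A A (T w))\<^sup>2 \<ge> ?t\<^sup>2 - 2 * \<delta>"
    using w by (simp add: q_def sphere_A_iff flip: power2_norm_A)
  moreover have "inner_A A (T w) (S w) = 0"
    using zero by (simp add: w_def blinfun.bilinear_simps inner_A_simps)
  ultimately show thesis using w that by blast
qed

text \<open>One-sided bounds of both signs come from using \<open>S\<close> and \<open>- S\<close>;
  a zero on the segment serves when neither point is good enough by itself.\<close>

lemma approx_maximiser_abs_inner_A_le:
  assumes T: "T \<in> bounded_ops_A A" and S: "S \<in> bounded_ops_A A"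
    and orth: "approx_orth_A \<epsilon> A T S" and "0 \<le> \<epsilon>" "0 < e"
  obtains x where "x \<in> sphere_A A" "(norm_A A (T x))\<^sup>2 \<ge> (opnorm_A A T)\<^sup>2 - e"
    "\<bar>inner_A A (T x) (S x)\<bar> \<le> \<epsilon> * opnorm_A A T * opnorm_A A S + e"
proof -
  let ?t = "opnorm_A A T" and ?s = "opnorm_A A S"
  define C where "C = 2 * \<epsilon> * ?t * ?s + 2 * ?t * ?s + (1 + ?s\<^sup>2)"
  have ts: "0 \<le> ?t" "0 \<le> ?s" using T S opnorm_A_nonneg by auto
  have ets: "0 \<le> \<epsilon> * ?t * ?s" using ts \<open>0 \<le> \<epsilon>\<close> by simp
  have "0 \<le> ?t * ?s" using ts by simp
  then have C: "1 + ?s\<^sup>2 \<le> C" using ets by (simp add: C_def)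
  then have "C > 0" using zero_le_power2[of ?s] by linarith
  \<comment> \<open>The bound 1 lets \<open>C\<close> dominate the error factor, and
    \<open>e / (2 * C)\<close> makes both errors at most \<open>e / 2\<close>. Half of
    \<open>e\<close> is needed since the segment argument doubles the loss.\<close>
  define r where "r = min 1 (e / (2 * C))"
  have r: "0 < r" "r \<le> 1" using \<open>0 < e\<close> \<open>C > 0\<close> by (auto simp: r_def)
  have "r * C \<le> e / (2 * C) * C"
    using \<open>C > 0\<close> by (intro mult_right_mono) (auto simp: r_def)
  then have rC: "r * C \<le> e / 2" using \<open>C > 0\<close> by simp
  have "r * (1 + ?s\<^sup>2) \<le> 1 * (1 + ?s\<^sup>2)"
    using r by (intro mult_right_mono) auto
  then have "r * (2 * \<epsilon> * ?t * ?s + 2 * ?t * ?s + r * (1 + ?s\<^sup>2)) \<le> r * C"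
    using r by (intro mult_left_mono) (auto simp: C_def)
  with rC have small1: "r * (2 * \<epsilon> * ?t * ?s + 2 * ?t * ?s + r * (1 + ?s\<^sup>2)) \<le> e / 2"
    by linarith
  have "r * (1 + ?s\<^sup>2) \<le> r * C" using r C by simp
  with rC have small2: "r * (1 + ?s\<^sup>2) \<le> e / 2" by linarith
  have S': "- S \<in> bounded_ops_A A" and opnorm_S': "opnorm_A A (- S) = ?s"
    using bounded_ops_A_scaleR[OF S, of "-1"] opnorm_A_scaleR[OF S, of "-1"] by auto
  \<comment> \<open>Orthogonality quantifies over scalars of both signs, so it is unaffected by
    negating \<open>S\<close>.\<close>
  have orth': "approx_orth_A \<epsilon> A T (- S)"
    unfolding approx_orth_A_def
  proof
    fix \<mu> :: real
    show "(opnorm_A A (T + \<mu> *\<^sub>R - S))\<^sup>2 \<ge> ?t\<^sup>2 - 2 * \<epsilon> * ?t * opnorm_A A (\<mu> *\<^sub>R - S)"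
      using orth[unfolded approx_orth_A_def, rule_format, of "- \<mu>"] by simp
  qed
  obtain x where x: "x \<in> sphere_A A" "(norm_A A (T x))\<^sup>2 \<ge> ?t\<^sup>2 - e / 2"
    "inner_A A (T x) (S x) \<ge> - (\<epsilon> * ?t * ?s) - e / 2"
  proof (rule approx_maximiser_inner_A_ge[OF T S orth r(1)])
    fix x assume x: "x \<in> sphere_A A"
      "(norm_A A (T x))\<^sup>2 \<ge> ?t\<^sup>2 - r * (2 * \<epsilon> * ?t * ?s + 2 * ?t * ?s + r * (1 + ?s\<^sup>2))"
      "inner_A A (T x) (S x) \<ge> - \<epsilon> * ?t * ?s - r * (1 + ?s\<^sup>2)"
    have "(norm_A A (T x))\<^sup>2 \<ge> ?t\<^sup>2 - e / 2" using x(2) small1 by linarith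
    moreover have "inner_A A (T x) (S x) \<ge> - (\<epsilon> * ?t * ?s) - e / 2" using x(3) small2 by simp
    ultimately show thesis using x(1) that by blast
  qed
  obtain y where y: "y \<in> sphere_A A" "(norm_A A (T y))\<^sup>2 \<ge> ?t\<^sup>2 - e / 2"
    "inner_A A (T y) (S y) \<le> \<epsilon> * ?t * ?s + e / 2"
  proof (rule approx_maximiser_inner_A_ge[OF T S' orth' r(1)], unfold opnorm_S')
    fix x assume x: "x \<in> sphere_A A"
      "(norm_A A (T x))\<^sup>2 \<ge> ?t\<^sup>2 - r * (2 * \<epsilon> * ?t * ?s + 2 * ?t * ?s + r * (1 + ?s\<^sup>2))"
      "inner_A A (T x) ((- S) x) \<ge> - \<epsilon> * ?t * ?s - r * (1 + ?s\<^sup>2)"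
    have "(norm_A A (T x))\<^sup>2 \<ge> ?t\<^sup>2 - e / 2" using x(2) small1 by linarith
    moreover have "inner_A A (T x) (S x) \<le> \<epsilon> * ?t * ?s + e / 2"
      using x(3) small2 by (simp add: blinfun.bilinear_simps inner_A_simps)
    ultimately show thesis using x(1) that by blast
  qed
  consider "inner_A A (T x) (S x) \<le> 0" | "inner_A A (T y) (S y) \<ge> 0"
    | "inner_A A (T x) (S x) \<ge> 0" "inner_A A (T y) (S y) \<le> 0"
    by linarith
  then show thesis
  proof cases
    \<comment> \<open>The value at \<open>x\<close> lies between
      \<open>- (\<epsilon> * ?t * ?s) - e / 2\<close> and 0, so its absolute value is already small
      enough; \<open>y\<close> is treated symmetrically.\<close>
    case 1
    with x ets \<open>0 < e\<close> show thesis by (intro that[of x]) auto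
  next
    case 2
    with y ets \<open>0 < e\<close> show thesis by (intro that[of y]) auto
  next
    case 3
    obtain w where "w \<in> sphere_A A" "(norm_A A (T w))\<^sup>2 \<ge> ?t\<^sup>2 - 2 * (e / 2)"
      "inner_A A (T w) (S w) = 0"
      using zero_of_inner_A_on_segment[OF T x(1,2) 3(1) y(1,2) 3(2)] by blast
    with ets \<open>0 < e\<close> show thesis by (intro that[of w]) auto
  qed
qed

section \<open>The two implications between orthogonality and the sequence condition\<close>

lemma approx_orth_A_imp_sequence:
  assumes T: "T \<in> bounded_ops_A A" and S: "S \<in> bounded_ops_A A"
    and orth: "approx_orth_A \<epsilon> A T S" and "0 \<le> \<epsilon>"
  shows "\<exists>x :: nat \<Rightarrow> 'a. (\<forall>n. x n \<in> sphere_A A) \<and>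
       (\<lambda>n. norm_A A (T (x n))) \<longlonglongrightarrow> opnorm_A A T \<and>
       (\<exists>l. (\<lambda>n. \<bar>inner_A A (T (x n)) (S (x n))\<bar>) \<longlonglongrightarrow> l \<and>
            l \<le> \<epsilon> * opnorm_A A T * opnorm_A A S)"
proof -
  let ?t = "opnorm_A A T" and ?b = "\<epsilon> * opnorm_A A T * opnorm_A A S"
  let ?e = "\<lambda>n. inverse (real (Suc n))"
  have "\<exists>x. x \<in> sphere_A A \<and> (norm_A A (T x))\<^sup>2 \<ge> ?t\<^sup>2 - ?e n
      \<and> \<bar>inner_A A (T x) (S x)\<bar> \<le> ?b + ?e n" for n
    using approx_maximiser_abs_inner_A_le[OF T S orth \<open>0 \<le> \<epsilon>\<close>, of "?e n"]
    by (metis inverse_positive_iff_positive of_nat_0_less_iff zero_less_Suc)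
  then obtain x where x: "\<And>n. x n \<in> sphere_A A" "\<And>n. (norm_A A (T (x n)))\<^sup>2 \<ge> ?t\<^sup>2 - ?e n"
    "\<And>n. \<bar>inner_A A (T (x n)) (S (x n))\<bar> \<le> ?b + ?e n"
    by metis
  have e0: "?e \<longlonglongrightarrow> 0" by (rule LIMSEQ_inverse_real_of_nat)
  have up: "(norm_A A (T (x n)))\<^sup>2 \<le> ?t\<^sup>2" for n
    using norm_A_apply_le_sphere[OF T x(1)] by (intro power_mono) auto
  have "(\<lambda>n. (norm_A A (T (x n)))\<^sup>2) \<longlonglongrightarrow> ?t\<^sup>2"
  proof (rule tendsto_sandwich[of "\<lambda>n. ?t\<^sup>2 - ?e n" _ _ "\<lambda>n. ?t\<^sup>2"])
    show "(\<lambda>n. ?t\<^sup>2 - ?e n) \<longlonglongrightarrow> ?t\<^sup>2"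
      using tendsto_diff[OF tendsto_const e0, of "?t\<^sup>2"] by simp
  qed (use x(2) up in auto)
  then have lim: "(\<lambda>n. norm_A A (T (x n))) \<longlonglongrightarrow> ?t"
    using tendsto_real_sqrt[of "\<lambda>n. (norm_A A (T (x n)))\<^sup>2" "?t\<^sup>2"] opnorm_A_nonneg[OF T] by simp
  \<comment> \<open>So far these values only have upper bounds tending to \<open>?b\<close> and need
    not converge. Lying in one compact interval, they have a convergent subsequence, along which the
    limit of the seminorms persists.\<close>
  have "\<bar>inner_A A (T (x n)) (S (x n))\<bar> \<in> {0..?b + 1}" for n
  proof -
    have "?e n \<le> 1" by (simp add: field_simps)
    with x(3)[of n] show ?thesis by simp
  qed
  then obtain l k where k: "strict_mono k"
    and l: "((\<lambda>n. \<bar>inner_A A (T (x n)) (S (x n))\<bar>) \<circ> k) \<longlonglongrightarrow> l"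
    using compact_Icc[of 0 "?b + 1"] unfolding compact_def by (metis (no_types, lifting))
  have "(\<lambda>n. ?b + ?e (k n)) \<longlonglongrightarrow> ?b + 0"
    using LIMSEQ_subseq_LIMSEQ[OF e0 k] by (intro tendsto_intros) (simp add: o_def)
  then have "l \<le> ?b"
    using LIMSEQ_le[OF l] x(3) by (auto simp: o_def)
  moreover have "(\<lambda>n. norm_A A (T (x (k n)))) \<longlonglongrightarrow> ?t"
    using LIMSEQ_subseq_LIMSEQ[OF lim k] by (simp add: o_def)
  ultimately show ?thesis
    using x(1) l by (intro exI[of _ "x \<circ> k"]) (auto simp: o_def)
qed

text \<open>Evaluate \<open>T + \<mu> *\<^sub>R S\<close> at \<open>x n\<close>, expand the square,
  drop the nonnegative term quadratic in \<open>\<mu>\<close>, and let \<open>n\<close> tend to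
  infinity.\<close>

lemma sequence_imp_approx_orth_A:
  assumes T: "T \<in> bounded_ops_A A" and S: "S \<in> bounded_ops_A A"
    and x: "\<And>n. x n \<in> sphere_A A"
    and lim: "(\<lambda>n. norm_A A (T (x n))) \<longlonglongrightarrow> opnorm_A A T"
    and l: "(\<lambda>n. \<bar>inner_A A (T (x n)) (S (x n))\<bar>) \<longlonglongrightarrow> l"
    and le: "l \<le> \<epsilon> * opnorm_A A T * opnorm_A A S"
  shows "approx_orth_A \<epsilon> A T S"
  unfolding approx_orth_A_def
proof
  fix \<mu> :: real
  let ?t = "opnorm_A A T" and ?s = "opnorm_A A S"
  let ?I = "\<lambda>n. inner_A A (T (x n)) (S (x n))"
  have "(norm_A A (T (x n)))\<^sup>2 - 2 * \<bar>\<mu>\<bar> * \<bar>?I n\<bar> \<le> (opnorm_A A (T + \<mu> *\<^sub>R S))\<^sup>2" for n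
  proof -
    have "- (\<mu> * ?I n) \<le> \<bar>\<mu>\<bar> * \<bar>?I n\<bar>"
      by (metis abs_ge_minus_self abs_mult)
    then have "(norm_A A (T (x n)))\<^sup>2 - 2 * \<bar>\<mu>\<bar> * \<bar>?I n\<bar> \<le> (norm_A A ((T + \<mu> *\<^sub>R S) (x n)))\<^sup>2"
      unfolding power2_norm_A_add_scaleR
      using zero_le_power2[of "\<mu> * norm_A A (S (x n))"] unfolding power_mult_distrib by linarith
    also have "\<dots> \<le> (opnorm_A A (T + \<mu> *\<^sub>R S))\<^sup>2"
      using norm_A_apply_le_sphere[OF bounded_ops_A_add[OF T bounded_ops_A_scaleR[OF S]] x]
      by (intro power_mono) auto
    finally show ?thesis .
  qed
  moreover have "(\<lambda>n. (norm_A A (T (x n)))\<^sup>2 - 2 * \<bar>\<mu>\<bar> * \<bar>?I n\<bar>) \<longlonglongrightarrow> ?t\<^sup>2 - 2 * \<bar>\<mu>\<bar> * l"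
    by (intro tendsto_intros lim l)
  ultimately have "?t\<^sup>2 - 2 * \<bar>\<mu>\<bar> * l \<le> (opnorm_A A (T + \<mu> *\<^sub>R S))\<^sup>2"
    by (intro LIMSEQ_le_const2) auto
  moreover have "\<bar>\<mu>\<bar> * l \<le> \<bar>\<mu>\<bar> * (\<epsilon> * ?t * ?s)"
    using le by (rule mult_left_mono) simp
  ultimately show "(opnorm_A A (T + \<mu> *\<^sub>R S))\<^sup>2 \<ge> ?t\<^sup>2 - 2 * \<epsilon> * ?t * opnorm_A A (\<mu> *\<^sub>R S)"
    by (simp add: opnorm_A_scaleR[OF S] algebra_simps)
qed

end

theorem theorem2p11:
  fixes A T S :: "'a::{real_inner,complete_space} \<Rightarrow>\<^sub>L 'a" and \<epsilon> :: real
  assumes "positive_op A" and "A \<noteq> 0"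
    and "T \<in> bounded_ops_A A" and "S \<in> bounded_ops_A A"
    and "0 \<le> \<epsilon>" and "\<epsilon> < 1"
  shows "approx_orth_A \<epsilon> A T S \<longleftrightarrow>
    (\<exists>x :: nat \<Rightarrow> 'a. (\<forall>n. x n \<in> sphere_A A) \<and>
       (\<lambda>n. norm_A A (T (x n))) \<longlonglongrightarrow> opnorm_A A T \<and>
       (\<exists>l. (\<lambda>n. \<bar>inner_A A (T (x n)) (S (x n))\<bar>) \<longlonglongrightarrow> l \<and>
            l \<le> \<epsilon> * opnorm_A A T * opnorm_A A S))"
proof -
  interpret nonzero_positive_operator A
    using assms(1,2) by unfold_locales
  show ?thesis
    using approx_orth_A_imp_sequence[OF assms(3,4) _ assms(5)]
      sequence_imp_approx_orth_A[OF assms(3,4)] by blast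
qed

end
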